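(* Let $n$ be a prime number, let $m,p_1,\dots,p_m\in\mathbb{Z}^{+}$, let $P^m=(p_1,\dots,p_m)$ be an oriented pretzel link, and let $\mathbb{Z}_n$ be the dihedral quandle. Put $$h=\sum_{1\le i_1<i_2<\dots<i_{m-1}\le m}p_{i_1}p_{i_2}\cdots p_{i_{m-1}}.$$ Then, with all congruences modulo $n$, the coloring number $|\mathrm{Hom}(\mathcal{Q}(P^m),\mathbb{Z}_n)|$ is given as follows. - It equals $n$ if $h\not\equiv 0$. - It equals $n^2$ if $h\equiv 0$ and the congruences $p_{i_1}p_{i_2}\cdots p_{i_{m-2}}\equiv 0$ with $1\le i_1<\dots<i_{m-2}\le m$ (that is, $p_1p_2\cdots p_{m-2}\equiv\dots\equiv p_3p_4\cdots p_m\equiv 0$) do not all hold. - In the intermediate cases, for each integer $j$ with $3\le j\le m-3$, it equals $n^{m-j}$ if $h\equiv 0$ and exactly $j$ of $p_1,\dots,p_m$ are coprime with $n$ while the rest are multiples of $n$. - It equals $n^{m-2}$ if $h\equiv 0$ and, among $p_1,\dots,p_m$, two are coprime with $n$ while the rest are multiples of $n$. - It equals $n^{m-1}$ if, among $p_1,\dots,p_m$, $m-1$ are multiples of $n$ and only one is coprime with $n$. - It equals $n^m$ if $p_1\equiv p_2\equiv\dots\equiv p_m\equiv 0$.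
   Context: A quandle is a set $X$ with a binary operation $\triangleright$ such that $x\triangleright x=x$ for all $x$; for each $y$ the map $x\mapsto x\triangleright y$ is invertible; and $(x\triangleright y)\triangleright z=(x\triangleright z)\triangleright(y\triangleright z)$ for all $x,y,z$. A quandle homomorphism $f$ satisfies $f(x\triangleright y)=f(x)\triangleright f(y)$. The dihedral quandle $\mathbb{Z}_n$ is the set of integers modulo $n$ with $x\triangleright y=2y-x \pmod n$. For an oriented link $K$ with diagram $D$, the fundamental quandle $\mathcal{Q}(K)$ is the quandle generated by the arcs of $D$ with one relation per crossing: if the overcrossing arc is $y$ (pointing up), and $x$ is the undercrossing arc on the right of $y$, then the undercrossing arc on the left of $y$ is $x\triangleright y$. $\mathrm{Hom}(\mathcal{Q}(K),X)$ is the set of quandle homomorphisms (colorings of $K$ by $X$); its cardinality is the coloring number of $K$ (with respect to $X$). Pretzel link: for a positive integer $m$ and nonzero integers $p_1,\dots,p_m$, the pretzel link $(p_1,\dots,p_m)$ (an $m$-pretzel link) is formed from $m$ tangles $A_1,\dots,A_m$ placed side by side, where $A_i$ is a vertical column of two strands twisted about each other with $|p_i|$ crossings, all of one fixed handedness if $p_i>0$ ("positive") and all of the opposite handedness if $p_i<0$ ("negative"). The NE endpoint of $A_i$ is joined to the NW endpoint of $A_{i+1}$, the SE endpoint of $A_i$ to the SW endpoint of $A_{i+1}$, and the outer endpoints are closed up by joining the NW (resp. SW) endpoint of $A_1$ to the NE (resp. SE) endpoint of $A_m$. Any orientation of the link may be chosen.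
   Formalization: The n^{m-1} case is stated only for m ≥ 2 and the n^{m-2} case only for m ≥ 3: for m = 1 with p_1 coprime to n, and for m = 2 with both coprime and h ≡ 0, these formulas would give 1, whereas the true values are n and n^2, as the first two cases assert. *)

theory Defs
  imports
    "HOL-Library.FuncSet"
    "HOL-Computational_Algebra.Primes"
    "HOL-Number_Theory.Cong"
begin

section \<open>Quandles\<close>

record 'a quandle =
  qset :: "'a set"
  qop :: "'a \<Rightarrow> 'a \<Rightarrow> 'a"  (infixl "\<triangleright>\<index>" 70)

definition is_quandle :: "('a, 'z) quandle_scheme \<Rightarrow> bool" where
  "is_quandle X \<longleftrightarrow>
     (\<forall>x\<in>qset X. \<forall>y\<in>qset X. x \<triangleright>\<^bsub>X\<^esub> y \<in> qset X) \<and>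
     (\<forall>x\<in>qset X. x \<triangleright>\<^bsub>X\<^esub> x = x) \<and>
     (\<forall>y\<in>qset X. bij_betw (\<lambda>x. x \<triangleright>\<^bsub>X\<^esub> y) (qset X) (qset X)) \<and>
     (\<forall>x\<in>qset X. \<forall>y\<in>qset X. \<forall>z\<in>qset X.
        (x \<triangleright>\<^bsub>X\<^esub> y) \<triangleright>\<^bsub>X\<^esub> z = (x \<triangleright>\<^bsub>X\<^esub> z) \<triangleright>\<^bsub>X\<^esub> (y \<triangleright>\<^bsub>X\<^esub> z))"

text \<open>Homomorphisms are taken extensional (undefined outside the carrier), so that the
  cardinality of the set of homomorphisms is meaningful.\<close>

definition quandle_hom :: "('a, 'y) quandle_scheme \<Rightarrow> ('b, 'z) quandle_scheme \<Rightarrow> ('a \<Rightarrow> 'b) set" where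
  "quandle_hom X Y =
     {f \<in> qset X \<rightarrow>\<^sub>E qset Y. \<forall>x\<in>qset X. \<forall>y\<in>qset X. f (x \<triangleright>\<^bsub>X\<^esub> y) = f x \<triangleright>\<^bsub>Y\<^esub> f y}"

definition dihedral_quandle :: "nat \<Rightarrow> int quandle" where
  "dihedral_quandle n = \<lparr>qset = {0..<int n}, qop = (\<lambda>x y. (2 * y - x) mod int n)\<rparr>"

lemma is_quandle_dihedral_quandle:
  assumes "n > 0"
  shows "is_quandle (dihedral_quandle n)"
proof -
  define f where "f y x = (2 * y - x) mod int n" for x y
  have f_mem: "f y x \<in> {0..<int n}" for x y
    using assms by (simp add: f_def)
  have f_f: "f y (f y x) = x" if "x \<in> {0..<int n}" for x y
    using that unfolding f_def mod_diff_right_eq by simp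
  have f_idem: "f x x = x" if "x \<in> {0..<int n}" for x
    using that by (simp add: f_def)
  have bij: "bij_betw (f y) {0..<int n} {0..<int n}" for y
    by (rule bij_betw_byWitness[where f' = "f y"]) (use f_f f_mem in blast)+
  have distrib: "f z (f y x) = f (f z y) (f z x)" for x y z
  proof -
    have "[2 * ((2 * z - y) mod int n) - (2 * z - x) mod int n = 2 * (2 * z - y) - (2 * z - x)] (mod int n)"
      by (intro cong_diff cong_mult) (simp_all add: cong_def)
    then have "f (f z y) (f z x) = (2 * (2 * z - y) - (2 * z - x)) mod int n"
      by (simp only: f_def cong_def)
    also have "2 * (2 * z - y) - (2 * z - x) = 2 * z - (2 * y - x)"
      by simp
    finally show ?thesis
      unfolding f_def mod_diff_right_eq by (rule HOL.sym)
  qed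
  have "dihedral_quandle n = \<lparr>qset = {0..<int n}, qop = (\<lambda>x y. f y x)\<rparr>"
    by (simp add: dihedral_quandle_def f_def)
  moreover have "is_quandle \<lparr>qset = {0..<int n}, qop = (\<lambda>x y. f y x)\<rparr>"
    unfolding is_quandle_def quandle.simps
    by (intro conjI ballI f_mem f_idem bij distrib)
  ultimately show ?thesis
    by simp
qed


section \<open>Quandles given by generators and relations\<close>

text \<open>Terms are built with an operation and a formal inverse, where
  \<open>Inv s t\<close> stands for the unique \<open>u\<close> with \<open>u \<triangleright> t = s\<close>.\<close>

datatype 'a qterm = Gen 'a | Op "'a qterm" "'a qterm" | Inv "'a qterm" "'a qterm"

definition qterms :: "'a set \<Rightarrow> 'a qterm set" where
  "qterms A = {t. set_qterm t \<subseteq> A}"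

inductive qcong :: "'a set \<Rightarrow> ('a qterm \<times> 'a qterm) set \<Rightarrow> 'a qterm \<Rightarrow> 'a qterm \<Rightarrow> bool"
  for A R where
  refl: "t \<in> qterms A \<Longrightarrow> qcong A R t t"
| sym: "qcong A R s t \<Longrightarrow> qcong A R t s"
| trans: "qcong A R s t \<Longrightarrow> qcong A R t u \<Longrightarrow> qcong A R s u"
| Op: "qcong A R s s' \<Longrightarrow> qcong A R t t' \<Longrightarrow> qcong A R (Op s t) (Op s' t')"
| Inv: "qcong A R s s' \<Longrightarrow> qcong A R t t' \<Longrightarrow> qcong A R (Inv s t) (Inv s' t')"
| idem: "t \<in> qterms A \<Longrightarrow> qcong A R (Op t t) t"
| Inv_Op: "s \<in> qterms A \<Longrightarrow> t \<in> qterms A \<Longrightarrow> qcong A R (Inv (Op s t) t) s"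
| Op_Inv: "s \<in> qterms A \<Longrightarrow> t \<in> qterms A \<Longrightarrow> qcong A R (Op (Inv s t) t) s"
| distrib: "s \<in> qterms A \<Longrightarrow> t \<in> qterms A \<Longrightarrow> u \<in> qterms A \<Longrightarrow>
    qcong A R (Op (Op s t) u) (Op (Op s u) (Op t u))"
| rel: "(s, t) \<in> R \<Longrightarrow> s \<in> qterms A \<Longrightarrow> t \<in> qterms A \<Longrightarrow> qcong A R s t"

definition qclass :: "'a set \<Rightarrow> ('a qterm \<times> 'a qterm) set \<Rightarrow> 'a qterm \<Rightarrow> 'a qterm set" where
  "qclass A R t = {s. qcong A R t s}"

text \<open>The operation picks representatives; it is characterised by \<open>qop_presented_quandle\<close> below.\<close>

definition presented_quandle ::
    "'a set \<Rightarrow> ('a qterm \<times> 'a qterm) set \<Rightarrow> 'a qterm set quandle" where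
  "presented_quandle A R =
     \<lparr>qset = qclass A R ` qterms A,
      qop = (\<lambda>X Y. qclass A R (Op (SOME s. s \<in> X) (SOME t. t \<in> Y)))\<rparr>"

lemma qterms_simps [simp]:
  "Gen a \<in> qterms A \<longleftrightarrow> a \<in> A"
  "Op s t \<in> qterms A \<longleftrightarrow> s \<in> qterms A \<and> t \<in> qterms A"
  "Inv s t \<in> qterms A \<longleftrightarrow> s \<in> qterms A \<and> t \<in> qterms A"
  by (auto simp: qterms_def)

lemma qcong_qterms: "qcong A R s t \<Longrightarrow> s \<in> qterms A \<and> t \<in> qterms A"
  by (induction rule: qcong.induct) auto

lemma qclass_eq_iff:
  "s \<in> qterms A \<Longrightarrow> qclass A R s = qclass A R t \<longleftrightarrow> qcong A R s t"
  unfolding qclass_def set_eq_iff mem_Collect_eq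
  by (meson qcong.refl qcong.sym qcong.trans)

lemma qset_presented_quandle: "qset (presented_quandle A R) = qclass A R ` qterms A"
  by (simp add: presented_quandle_def)

lemma qop_presented_quandle:
  assumes "s \<in> qterms A" "t \<in> qterms A"
  shows "qclass A R s \<triangleright>\<^bsub>presented_quandle A R\<^esub> qclass A R t = qclass A R (Op s t)"
proof -
  have *: "qcong A R u (SOME u'. u' \<in> qclass A R u)" if "u \<in> qterms A" for u
  proof -
    have "u \<in> qclass A R u"
      using that by (simp add: qclass_def qcong.refl)
    then have "(SOME u'. u' \<in> qclass A R u) \<in> qclass A R u"
      by (rule someI)
    then show ?thesis
      by (simp only: qclass_def mem_Collect_eq)
  qed
  have "qcong A R (Op s t) (Op (SOME s'. s' \<in> qclass A R s) (SOME t'. t' \<in> qclass A R t))"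
    by (rule qcong.Op[OF *[OF assms(1)] *[OF assms(2)]])
  moreover have "Op s t \<in> qterms A"
    using assms by simp
  ultimately have "qclass A R (Op s t) =
      qclass A R (Op (SOME s'. s' \<in> qclass A R s) (SOME t'. t' \<in> qclass A R t))"
    by (simp only: qclass_eq_iff)
  then show ?thesis
    by (simp add: presented_quandle_def)
qed

lemma is_quandle_presented_quandle: "is_quandle (presented_quandle A R)"
proof -
  have "bij_betw (\<lambda>x. x \<triangleright>\<^bsub>presented_quandle A R\<^esub> qclass A R t)
      (qclass A R ` qterms A) (qclass A R ` qterms A)" if t: "t \<in> qterms A" for t
  proof (rule bij_betwI')
    fix x y assume "x \<in> qclass A R ` qterms A" "y \<in> qclass A R ` qterms A"
    then obtain s u where s: "x = qclass A R s" "s \<in> qterms A"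
      and u: "y = qclass A R u" "u \<in> qterms A" by blast
    have "qcong A R s u" if "qcong A R (Op s t) (Op u t)"
    proof -
      have "qcong A R (Inv (Op s t) t) (Inv (Op u t) t)"
        using that t by (intro qcong.Inv qcong.refl)
      from qcong.trans[OF qcong.sym[OF qcong.Inv_Op[OF s(2) t]]
          qcong.trans[OF this qcong.Inv_Op[OF u(2) t]]]
      show ?thesis .
    qed
    then show "(x \<triangleright>\<^bsub>presented_quandle A R\<^esub> qclass A R t =
        y \<triangleright>\<^bsub>presented_quandle A R\<^esub> qclass A R t) = (x = y)"
      using s u t
      by (auto simp: qop_presented_quandle qclass_eq_iff intro: qcong.Op qcong.refl)
  next
    fix x assume "x \<in> qclass A R ` qterms A"
    then show "x \<triangleright>\<^bsub>presented_quandle A R\<^esub> qclass A R t \<in> qclass A R ` qterms A"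
      using t by (auto simp: qop_presented_quandle)
  next
    fix y assume "y \<in> qclass A R ` qterms A"
    then obtain u where u: "y = qclass A R u" "u \<in> qterms A" by blast
    have "qclass A R (Inv u t) \<triangleright>\<^bsub>presented_quandle A R\<^esub> qclass A R t = y"
      using u t by (simp add: qop_presented_quandle qclass_eq_iff qcong.Op_Inv)
    moreover have "qclass A R (Inv u t) \<in> qclass A R ` qterms A"
      using u t by simp
    ultimately show "\<exists>x\<in>qclass A R ` qterms A. y = x \<triangleright>\<^bsub>presented_quandle A R\<^esub> qclass A R t"
      by blast
  qed
  then show ?thesis
    by (auto simp: is_quandle_def qset_presented_quandle qop_presented_quandle qclass_eq_iff
        qcong.idem qcong.distrib)
qed


section \<open>Link diagrams and the fundamental quandle\<close>

text \<open>Every crossing is drawn as an X; its two strands are the diagonals, and it meets the rest of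
  the diagram in its four corners.  A diagram (each of whose components meets a crossing) consists of
  the crossings, the way their corners are joined by edges, and, for each crossing, the pair of
  opposite corners lying on the overcrossing strand.  Planarity plays no role in the
  definition of the fundamental quandle and is not demanded.\<close>

datatype corner = NE | NW | SW | SE

fun opposite :: "corner \<Rightarrow> corner" where
  "opposite NE = SW" | "opposite SW = NE" | "opposite NW = SE" | "opposite SE = NW"

text \<open>The strand leaving the crossing through corner \<open>q\<close>, turned so that it points up,
  has \<open>left_of q\<close> on its left and \<open>right_of q\<close> on its right.\<close>

fun left_of :: "corner \<Rightarrow> corner" where
  "left_of NE = NW" | "left_of NW = SW" | "left_of SW = SE" | "left_of SE = NE"

definition right_of :: "corner \<Rightarrow> corner" where
  "right_of q = opposite (left_of q)"

record 'c diagram =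
  crossings :: "'c set"
  joined :: "'c \<times> corner \<Rightarrow> 'c \<times> corner"
  over :: "'c \<Rightarrow> corner set"

definition ends :: "('c, 'z) diagram_scheme \<Rightarrow> ('c \<times> corner) set" where
  "ends D = crossings D \<times> UNIV"

definition is_diagram :: "('c, 'z) diagram_scheme \<Rightarrow> bool" where
  "is_diagram D \<longleftrightarrow>
     finite (crossings D) \<and>
     (\<forall>e\<in>ends D. joined D e \<in> ends D \<and> joined D e \<noteq> e \<and> joined D (joined D e) = e) \<and>
     (\<forall>c\<in>crossings D. over D c = {NE, SW} \<or> over D c = {NW, SE})"

text \<open>An orientation tells for each corner whether the strand leaves (rather than enters) the
  crossing there.\<close>

definition is_orientation :: "('c, 'z) diagram_scheme \<Rightarrow> ('c \<times> corner \<Rightarrow> bool) \<Rightarrow> bool" where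
  "is_orientation D out \<longleftrightarrow>
     (\<forall>c\<in>crossings D. \<forall>q. (out (c, opposite q) \<longleftrightarrow> \<not> out (c, q)) \<and>
                            (out (joined D (c, q)) \<longleftrightarrow> \<not> out (c, q)))"

text \<open>An arc runs along edges and over crossings, and is represented by the set of ends on it.
  In a diagram both kinds of steps are symmetric, so arcs are equivalence classes of ends.\<close>

definition arc_step :: "('c, 'z) diagram_scheme \<Rightarrow> ('c \<times> corner) rel" where
  "arc_step D =
     {(e, joined D e) | e. e \<in> ends D} \<union>
     {((c, q), (c, opposite q)) | c q. c \<in> crossings D \<and> q \<in> over D c}"

definition arc_of :: "('c, 'z) diagram_scheme \<Rightarrow> 'c \<times> corner \<Rightarrow> ('c \<times> corner) set" where
  "arc_of D e = (arc_step D)\<^sup>* `` {e}"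

definition arcs :: "('c, 'z) diagram_scheme \<Rightarrow> ('c \<times> corner) set set" where
  "arcs D = arc_of D ` ends D"

definition crossing_relations ::
    "('c, 'z) diagram_scheme \<Rightarrow> ('c \<times> corner \<Rightarrow> bool) \<Rightarrow>
      (('c \<times> corner) set qterm \<times> ('c \<times> corner) set qterm) set" where
  "crossing_relations D out =
     {(Gen (arc_of D (c, left_of q)),
       Op (Gen (arc_of D (c, right_of q))) (Gen (arc_of D (c, q)))) |
      c q. c \<in> crossings D \<and> q \<in> over D c \<and> out (c, q)}"

definition fundamental_quandle ::
    "('c, 'z) diagram_scheme \<Rightarrow> ('c \<times> corner \<Rightarrow> bool) \<Rightarrow>
      ('c \<times> corner) set qterm set quandle" where
  "fundamental_quandle D out = presented_quandle (arcs D) (crossing_relations D out)"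

definition coloring_number ::
    "('c, 'y) diagram_scheme \<Rightarrow> ('c \<times> corner \<Rightarrow> bool) \<Rightarrow> ('a, 'z) quandle_scheme \<Rightarrow> nat" where
  "coloring_number D out X = card (quandle_hom (fundamental_quandle D out) X)"


section \<open>Pretzel links\<close>

text \<open>The crossing \<open>(i, k)\<close> is the \<open>k\<close>-th one from the top in the \<open>i\<close>-th column, where
  \<open>1 \<le> i \<le> m\<close> and \<open>1 \<le> k \<le> \<bar>p i\<bar>\<close>.  The last column is followed by the first one.\<close>

definition next_col :: "nat \<Rightarrow> nat \<Rightarrow> nat" where
  "next_col m i = (if i = m then 1 else i + 1)"

definition prev_col :: "nat \<Rightarrow> nat \<Rightarrow> nat" where
  "prev_col m i = (if i = 1 then m else i - 1)"

fun pretzel_joined ::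
    "nat \<Rightarrow> (nat \<Rightarrow> int) \<Rightarrow> (nat \<times> nat) \<times> corner \<Rightarrow> (nat \<times> nat) \<times> corner" where
  "pretzel_joined m p ((i, k), NE) =
     (if k = 1 then ((next_col m i, 1), NW) else ((i, k - 1), SE))"
| "pretzel_joined m p ((i, k), NW) =
     (if k = 1 then ((prev_col m i, 1), NE) else ((i, k - 1), SW))"
| "pretzel_joined m p ((i, k), SE) =
     (if k = nat \<bar>p i\<bar> then ((next_col m i, nat \<bar>p (next_col m i)\<bar>), SW) else ((i, k + 1), NE))"
| "pretzel_joined m p ((i, k), SW) =
     (if k = nat \<bar>p i\<bar> then ((prev_col m i, nat \<bar>p (prev_col m i)\<bar>), SE) else ((i, k + 1), NW))"

definition pretzel_link :: "nat \<Rightarrow> (nat \<Rightarrow> int) \<Rightarrow> (nat \<times> nat) diagram" where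
  "pretzel_link m p =
     \<lparr>crossings = {(i, k). 1 \<le> i \<and> i \<le> m \<and> 1 \<le> k \<and> k \<le> nat \<bar>p i\<bar>},
      joined = pretzel_joined m p,
      over = (\<lambda>(i, k). if p i > 0 then {NE, SW} else {NW, SE})\<rparr>"

lemma is_diagram_pretzel_link:
  assumes "\<forall>i\<in>{1..m}. p i \<noteq> 0"
  shows "is_diagram (pretzel_link m p)"
proof -
  have pos: "1 \<le> nat \<bar>p i\<bar>" if "1 \<le> i" "i \<le> m" for i
    using assms that by (force simp: Suc_le_eq)
  have "crossings (pretzel_link m p) = Sigma {1..m} (\<lambda>i. {1..nat \<bar>p i\<bar>})"
    by (auto simp: pretzel_link_def)
  then have "finite (crossings (pretzel_link m p))"
    by simp
  moreover have "over (pretzel_link m p) c = {NE, SW} \<or> over (pretzel_link m p) c = {NW, SE}" for c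
    by (simp add: pretzel_link_def split: prod.split)
  moreover have "pretzel_joined m p ((i, k), q) \<in> ends (pretzel_link m p) \<and>
      pretzel_joined m p ((i, k), q) \<noteq> ((i, k), q) \<and>
      pretzel_joined m p (pretzel_joined m p ((i, k), q)) = ((i, k), q)"
    if ik: "1 \<le> i" "i \<le> m" "1 \<le> k" "k \<le> nat \<bar>p i\<bar>" for i k q
  proof -
    have cols: "1 \<le> next_col m i" "next_col m i \<le> m" "1 \<le> prev_col m i" "prev_col m i \<le> m"
      "next_col m (prev_col m i) = i" "prev_col m (next_col m i) = i"
      using ik by (auto simp: next_col_def prev_col_def)
    note len = pos[OF cols(1,2)] pos[OF cols(3,4)]
    obtain k' where "k = Suc k'"
      using ik by (cases k) auto
    with ik cols len show ?thesis
      by (cases q) (auto simp: ends_def pretzel_link_def)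
  qed
  ultimately show ?thesis
    unfolding is_diagram_def by (auto simp: ends_def pretzel_link_def)
qed


section \<open>Coprimality pattern\<close>

definition exactly_coprime :: "nat \<Rightarrow> nat \<Rightarrow> (nat \<Rightarrow> int) \<Rightarrow> nat \<Rightarrow> bool" where
  "exactly_coprime n m p j \<longleftrightarrow>
     card {i\<in>{1..m}. coprime (p i) (int n)} = j \<and>
     (\<forall>i\<in>{1..m}. \<not> coprime (p i) (int n) \<longrightarrow> int n dvd p i)"

end

theory Submission
  imports Defs
begin

text \<open>
  A homomorphism out of a presented quandle is an assignment of values to the generators that
  respects the relations.  For the fundamental quandle and the dihedral quandle this says that arcs
  are labelled by residues modulo \<open>n\<close> such that at every crossing the two undercrossing labels add
  up to twice the overcrossing label, a condition that no longer sees the orientation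
  (\<open>coloring_number_dihedral_quandle\<close>).

  In a column of a pretzel link each crossing sends the two labels \<open>(a, b)\<close> above it to
  \<open>(b, 2 * b - a)\<close>.  The difference \<open>b - a\<close> is preserved and both labels move by it, so below \<open>k\<close>
  crossings the labels are \<open>(a + k * (b - a), b + k * (b - a))\<close>
  (\<open>twist_region_coloring\<close>).  Hence the labels \<open>x i\<close> of the arcs that join the tops of neighbouring
  columns determine the whole coloring.  With \<open>d i\<close> the difference of the labels at the top of
  column \<open>i\<close>, the edge joining the bottoms of the columns \<open>i\<close> and \<open>i + 1\<close> demands
  \<open>p i * d i = p (i + 1) * d (i + 1)\<close>.  So a coloring amounts to one label, chosen freely, and
  differences \<open>d i\<close> with sum zero for which the products \<open>p i * d i\<close> have a common value \<open>t\<close>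
  (\<open>coloring_number_pretzel_link\<close>).

  For \<open>n\<close> prime these differences are easily counted.  If no \<open>p i\<close> is a multiple of \<open>n\<close>, then \<open>t\<close>
  determines all \<open>d i\<close>, and multiplying their sum by the product of all \<open>p i\<close> gives \<open>t * h\<close>; so
  \<open>t\<close> is free or zero according to whether \<open>h\<close> vanishes (\<open>card_slopes_units\<close>).  If \<open>z > 0\<close> of the
  \<open>p i\<close> are multiples of \<open>n\<close>, then \<open>t\<close> is zero, the other differences vanish, and the \<open>z\<close> remaining
  ones are constrained only by their sum, which gives \<open>n ^ z\<close> colorings in all
  (\<open>card_slopes_nonunits\<close>).  Finally \<open>h\<close> vanishes when \<open>z \<ge> 2\<close> and does not when \<open>z = 1\<close>, and
  a nonvanishing product of \<open>m - 2\<close> of the \<open>p i\<close> exists only when \<open>z \<le> 2\<close>; this turns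
  the count into the stated cases.
\<close>

section \<open>Homomorphisms out of a presented quandle\<close>

primrec qeval :: "('b, 'z) quandle_scheme \<Rightarrow> ('a \<Rightarrow> 'b) \<Rightarrow> 'a qterm \<Rightarrow> 'b" where
  "qeval X f (Gen a) = f a"
| "qeval X f (Op s t) = qeval X f s \<triangleright>\<^bsub>X\<^esub> qeval X f t"
| "qeval X f (Inv s t) = inv_into (qset X) (\<lambda>x. x \<triangleright>\<^bsub>X\<^esub> qeval X f t) (qeval X f s)"

lemma
  assumes "is_quandle X" "x \<in> qset X" "y \<in> qset X"
  shows quandle_op_closed: "x \<triangleright>\<^bsub>X\<^esub> y \<in> qset X"
    and quandle_right_bij: "bij_betw (\<lambda>x. x \<triangleright>\<^bsub>X\<^esub> y) (qset X) (qset X)"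
  using assms unfolding is_quandle_def by blast+

lemma quandle_idem: "is_quandle X \<Longrightarrow> x \<in> qset X \<Longrightarrow> x \<triangleright>\<^bsub>X\<^esub> x = x"
  unfolding is_quandle_def by blast

lemma quandle_distrib:
  "is_quandle X \<Longrightarrow> x \<in> qset X \<Longrightarrow> y \<in> qset X \<Longrightarrow> z \<in> qset X \<Longrightarrow>
    (x \<triangleright>\<^bsub>X\<^esub> y) \<triangleright>\<^bsub>X\<^esub> z = (x \<triangleright>\<^bsub>X\<^esub> z) \<triangleright>\<^bsub>X\<^esub> (y \<triangleright>\<^bsub>X\<^esub> z)"
  unfolding is_quandle_def by blast

lemma qeval_in_qset:
  assumes "is_quandle X" "f \<in> A \<rightarrow> qset X" "t \<in> qterms A"
  shows "qeval X f t \<in> qset X"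
  using assms(3)
proof (induction t)
  case (Inv s t)
  then have "qeval X f s \<in> (\<lambda>x. x \<triangleright>\<^bsub>X\<^esub> qeval X f t) ` qset X"
    using quandle_right_bij[OF assms(1)] by (auto simp: bij_betw_def)
  then show ?case
    by (simp add: inv_into_into)
qed (use assms quandle_op_closed in auto)

lemma qeval_qcong:
  assumes X: "is_quandle X" and f: "f \<in> A \<rightarrow> qset X"
    and R: "\<And>s t. (s, t) \<in> R \<Longrightarrow> s \<in> qterms A \<Longrightarrow> t \<in> qterms A \<Longrightarrow> qeval X f s = qeval X f t"
    and "qcong A R s t"
  shows "qeval X f s = qeval X f t"
  using assms(4)
proof (induction rule: qcong.induct)
  case (idem t)
  then show ?case
    using quandle_idem[OF X] qeval_in_qset[OF X f] by simp
next
  case (Inv_Op s t)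
  then show ?case
    using bij_betw_imp_inj_on[OF quandle_right_bij[OF X]] qeval_in_qset[OF X f]
    unfolding qeval.simps by (intro inv_into_f_f) blast+
next
  case (Op_Inv s t)
  then have "qeval X f s \<in> (\<lambda>x. x \<triangleright>\<^bsub>X\<^esub> qeval X f t) ` qset X"
    using bij_betw_imp_surj_on[OF quandle_right_bij[OF X]] qeval_in_qset[OF X f] by blast
  then show ?case
    by (simp add: f_inv_into_f[where f = "\<lambda>x. x \<triangleright>\<^bsub>X\<^esub> qeval X f t"])
next
  case (distrib s t u)
  then show ?case
    unfolding qeval.simps by (intro quandle_distrib[OF X] qeval_in_qset[OF X f])
qed (use R in auto)

text \<open>A homomorphism is only assumed to preserve \<open>\<triangleright>\<close>; it preserves the formal inverse as well because
  right translations of the target are injective.\<close>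

lemma quandle_hom_eq_qeval:
  assumes X: "is_quandle X" and \<phi>: "\<phi> \<in> quandle_hom (presented_quandle A R) X"
    and "t \<in> qterms A"
  shows "\<phi> (qclass A R t) = qeval X (\<lambda>a\<in>A. \<phi> (qclass A R (Gen a))) t"
  using assms(3)
proof (induction t)
  case (Op s t)
  then have "\<phi> (qclass A R (Op s t)) = \<phi> (qclass A R s) \<triangleright>\<^bsub>X\<^esub> \<phi> (qclass A R t)"
    using \<phi> by (simp add: quandle_hom_def qset_presented_quandle flip: qop_presented_quandle)
  then show ?case
    using Op by simp
next
  case (Inv s t)
  have mem: "\<phi> (qclass A R u) \<in> qset X" if "u \<in> qterms A" for u
    using \<phi> that by (auto simp: quandle_hom_def qset_presented_quandle)
  have "\<phi> (qclass A R (Inv s t)) \<triangleright>\<^bsub>X\<^esub> \<phi> (qclass A R t) = \<phi> (qclass A R (Op (Inv s t) t))"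
    using \<phi> Inv.prems
    by (simp add: quandle_hom_def qset_presented_quandle flip: qop_presented_quandle)
  also have "qclass A R (Op (Inv s t) t) = qclass A R s"
    using Inv.prems by (simp add: qclass_eq_iff qcong.Op_Inv)
  finally have "inv_into (qset X) (\<lambda>x. x \<triangleright>\<^bsub>X\<^esub> \<phi> (qclass A R t)) (\<phi> (qclass A R s)) =
      \<phi> (qclass A R (Inv s t))"
    using bij_betw_imp_inj_on[OF quandle_right_bij[OF X]] mem Inv.prems
    by (intro inv_into_f_eq) auto
  then show ?case
    using Inv by simp
qed auto

text \<open>The universal property of a presentation, as a count.\<close>

theorem card_quandle_hom_presented_quandle:
  fixes A :: "'a set" and X :: "('b, 'z) quandle_scheme"
  assumes X: "is_quandle X"
  shows "card (quandle_hom (presented_quandle A R) X) =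
    card {f \<in> A \<rightarrow>\<^sub>E qset X. \<forall>(s, t)\<in>R. s \<in> qterms A \<and> t \<in> qterms A \<longrightarrow> qeval X f s = qeval X f t}"
    (is "card ?H = card ?F")
proof -
  define res where "res \<phi> = (\<lambda>a\<in>A. \<phi> (qclass A R (Gen a)))" for \<phi> :: "'a qterm set \<Rightarrow> 'b"
  have eval: "\<phi> (qclass A R t) = qeval X (res \<phi>) t" if "\<phi> \<in> ?H" "t \<in> qterms A" for \<phi> t
    using quandle_hom_eq_qeval[OF X that] by (simp add: res_def)
  have "bij_betw res ?H ?F"
  proof (rule bij_betwI')
    fix \<phi> \<psi> assume \<phi>: "\<phi> \<in> ?H" and \<psi>: "\<psi> \<in> ?H"
    have "\<phi> = \<psi>" if "res \<phi> = res \<psi>"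
    proof (rule PiE_ext)
      show "\<phi> \<in> qset (presented_quandle A R) \<rightarrow>\<^sub>E qset X" "\<psi> \<in> qset (presented_quandle A R) \<rightarrow>\<^sub>E qset X"
        using \<phi> \<psi> by (simp_all add: quandle_hom_def)
      show "\<phi> C = \<psi> C" if "C \<in> qset (presented_quandle A R)" for C
        using that \<open>res \<phi> = res \<psi>\<close> eval[OF \<phi>] eval[OF \<psi>] by (auto simp: qset_presented_quandle)
    qed
    then show "(res \<phi> = res \<psi>) = (\<phi> = \<psi>)"
      by blast
  next
    fix \<phi> assume \<phi>: "\<phi> \<in> ?H"
    have "qeval X (res \<phi>) s = qeval X (res \<phi>) t"
      if "(s, t) \<in> R" "s \<in> qterms A" "t \<in> qterms A" for s t
    proof -
      have "qclass A R s = qclass A R t"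
        using that by (simp add: qclass_eq_iff qcong.rel)
      then show ?thesis
        using eval[OF \<phi>] that by metis
    qed
    moreover have "res \<phi> \<in> A \<rightarrow>\<^sub>E qset X"
      using \<phi> by (auto simp: res_def quandle_hom_def qset_presented_quandle)
    ultimately show "res \<phi> \<in> ?F"
      by auto
  next
    fix f assume f: "f \<in> ?F"
    then have f_mem: "f \<in> A \<rightarrow> qset X"
      by auto
    have cong: "qeval X f s = qeval X f t" if "qcong A R s t" for s t
      using f by (intro qeval_qcong[OF X f_mem _ that]) auto
    define \<phi> where "\<phi> = (\<lambda>C\<in>qclass A R ` qterms A. qeval X f (SOME s. s \<in> C))"
    have \<phi>: "\<phi> (qclass A R t) = qeval X f t" if t: "t \<in> qterms A" for t
    proof -
      have "t \<in> qclass A R t"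
        using t by (simp add: qclass_def qcong.refl)
      then have "(SOME s. s \<in> qclass A R t) \<in> qclass A R t"
        by (rule someI)
      then have "qcong A R t (SOME s. s \<in> qclass A R t)"
        by (simp only: qclass_def mem_Collect_eq)
      then show ?thesis
        using t cong by (simp add: \<phi>_def)
    qed
    have "\<phi> \<in> ?H"
      unfolding quandle_hom_def qset_presented_quandle
    proof (intro CollectI conjI ballI)
      show "\<phi> \<in> qclass A R ` qterms A \<rightarrow>\<^sub>E qset X"
        using qeval_in_qset[OF X f_mem] by (auto simp: \<phi> intro!: PiE_I) (simp add: \<phi>_def)
      fix C C' assume "C \<in> qclass A R ` qterms A" "C' \<in> qclass A R ` qterms A"
      then show "\<phi> (C \<triangleright>\<^bsub>presented_quandle A R\<^esub> C') = \<phi> C \<triangleright>\<^bsub>X\<^esub> \<phi> C'"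
        by (auto simp: qop_presented_quandle \<phi>)
    qed
    moreover have "f = res \<phi>"
      using f by (intro PiE_ext[of f A "\<lambda>_. qset X"]) (auto simp: res_def \<phi> PiE_mem)
    ultimately show "\<exists>\<phi>\<in>?H. f = res \<phi>"
      by blast
  qed
  then show ?thesis
    by (rule bij_betw_same_card)
qed

section \<open>Colorings by a dihedral quandle\<close>

text \<open>Labelling the ends instead of the arcs avoids handling equivalence classes: a function that is
  invariant along edges and under passing over a crossing is the same as a function on arcs.\<close>

definition fox_colorings :: "('c, 'z) diagram_scheme \<Rightarrow> nat \<Rightarrow> ('c \<times> corner \<Rightarrow> int) set" where
  "fox_colorings D n =
     {g \<in> ends D \<rightarrow>\<^sub>E {0..<int n}.
        (\<forall>e\<in>ends D. g (joined D e) = g e) \<and>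
        (\<forall>c\<in>crossings D. \<forall>q\<in>over D c. g (c, opposite q) = g (c, q) \<and>
           [g (c, left_of q) + g (c, right_of q) = 2 * g (c, q)] (mod int n))}"

lemma left_of_opposite: "left_of (opposite q) = right_of q"
  by (cases q) (simp_all add: right_of_def)

lemma right_of_opposite: "right_of (opposite q) = left_of q"
  by (cases q) (simp_all add: right_of_def)

lemma opposite_opposite [simp]: "opposite (opposite q) = q"
  by (cases q) simp_all

lemma opposite_in_over:
  assumes "is_diagram D" "c \<in> crossings D" "q \<in> over D c"
  shows "opposite q \<in> over D c"
proof -
  have "over D c = {NE, SW} \<or> over D c = {NW, SE}"
    using assms by (simp add: is_diagram_def)
  then show ?thesis
    using assms(3) by (elim disjE; cases q; simp)
qed

lemma sym_arc_step:
  assumes "is_diagram D"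
  shows "sym (arc_step D)"
proof (rule symI)
  fix e e' assume "(e, e') \<in> arc_step D"
  then consider "e \<in> ends D" "e' = joined D e"
    | c q where "c \<in> crossings D" "q \<in> over D c" "e = (c, q)" "e' = (c, opposite q)"
    by (auto simp: arc_step_def)
  then show "(e', e) \<in> arc_step D"
  proof cases
    case 1
    then have "e' \<in> ends D" "e = joined D e'"
      using assms by (auto simp: is_diagram_def)
    then show ?thesis
      unfolding arc_step_def by blast
  next
    case 2
    then have "opposite q \<in> over D c"
      using opposite_in_over[OF assms] by simp
    then have "((c, opposite q), (c, opposite (opposite q))) \<in> arc_step D"
      using 2 unfolding arc_step_def by blast
    then show ?thesis
      using 2 by simp
  qed
qed

lemma arc_of_eqI:
  assumes "is_diagram D" "(e, e') \<in> (arc_step D)\<^sup>*"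
  shows "arc_of D e = arc_of D e'"
  using assms sym_rtrancl[OF sym_arc_step[OF assms(1)]]
  by (auto simp: arc_of_def dest: symD intro: rtrancl_trans)

lemma fox_coloring_constant_on_arcs:
  assumes "g \<in> fox_colorings D n" "(e, e') \<in> (arc_step D)\<^sup>*"
  shows "g e = g e'"
  using assms(2)
proof (induction rule: rtrancl_induct)
  case (step y z)
  then show ?case
    using assms(1) by (auto simp: arc_step_def fox_colorings_def)
qed simp

lemma residue_eqI:
  assumes "x \<in> {0..<int n}" "y \<in> {0..<int n}" "[x = y] (mod int n)"
  shows "x = y"
  using assms by (simp add: cong_def)

lemma dihedral_op_eq_iff:
  fixes x y z :: int
  assumes "z \<in> {0..<int n}"
  shows "z = (2 * y - x) mod int n \<longleftrightarrow> [z + x = 2 * y] (mod int n)"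
proof -
  have "z = z mod int n"
    using assms by simp
  then have "z = (2 * y - x) mod int n \<longleftrightarrow> [z = 2 * y - x] (mod int n)"
    by (simp add: cong_def)
  also have "\<dots> \<longleftrightarrow> [z + x = 2 * y] (mod int n)"
    by (simp add: cong_iff_dvd_diff algebra_simps)
  finally show ?thesis .
qed

text \<open>Reversing an overcrossing strand swaps its left and right, and the crossing relation
  \<open>left + right = 2 * over\<close> is symmetric in the two.  This is why the orientation disappears.\<close>

theorem coloring_number_dihedral_quandle:
  assumes D: "is_diagram D" and out: "is_orientation D out" and n: "n > 0"
  shows "coloring_number D out (dihedral_quandle n) = card (fox_colorings D n)"
proof -
  let ?X = "dihedral_quandle n"
  let ?R = "crossing_relations D out"
  define F where "F = {f \<in> arcs D \<rightarrow>\<^sub>E qset ?X.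
    \<forall>(s, t)\<in>?R. s \<in> qterms (arcs D) \<and> t \<in> qterms (arcs D) \<longrightarrow> qeval ?X f s = qeval ?X f t}"
  have arc_mem: "arc_of D (c, q) \<in> arcs D" if "c \<in> crossings D" for c q
    using that by (auto simp: arcs_def ends_def)
  have F: "f \<in> F \<longleftrightarrow> f \<in> arcs D \<rightarrow>\<^sub>E {0..<int n} \<and>
      (\<forall>c\<in>crossings D. \<forall>q\<in>over D c. out (c, q) \<longrightarrow>
        f (arc_of D (c, left_of q)) =
          (2 * f (arc_of D (c, q)) - f (arc_of D (c, right_of q))) mod int n)" for f
  proof -
    have "(\<forall>(s, t)\<in>?R. P s t) \<longleftrightarrow> (\<forall>c\<in>crossings D. \<forall>q\<in>over D c. out (c, q) \<longrightarrow>
        P (Gen (arc_of D (c, left_of q)))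
          (Op (Gen (arc_of D (c, right_of q))) (Gen (arc_of D (c, q)))))" for P
      unfolding crossing_relations_def by blast
    then show ?thesis
      using arc_mem by (simp add: F_def dihedral_quandle_def)
  qed
  have arc_joined: "arc_of D (joined D e) = arc_of D e" if "e \<in> ends D" for e
    using that
    by (intro arc_of_eqI[OF D, symmetric] r_into_rtrancl) (unfold arc_step_def, blast)
  have arc_over: "arc_of D (c, opposite q) = arc_of D (c, q)"
    if "c \<in> crossings D" "q \<in> over D c" for c q
    using that by (intro arc_of_eqI[OF D, symmetric] r_into_rtrancl) (auto simp: arc_step_def)
  define pull where "pull f = (\<lambda>e\<in>ends D. f (arc_of D e))" for f :: "('a \<times> corner) set \<Rightarrow> int"
  have ends_mem: "(c, q) \<in> ends D \<longleftrightarrow> c \<in> crossings D" for c q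
    by (simp add: ends_def)
  have joined_mem: "joined D e \<in> ends D" if "e \<in> ends D" for e
    using D that by (simp add: is_diagram_def)
  have "bij_betw pull F (fox_colorings D n)"
  proof (rule bij_betwI')
    fix f f' assume f: "f \<in> F" and f': "f' \<in> F"
    have "f = f'" if "pull f = pull f'"
    proof (rule PiE_ext)
      show "f \<in> arcs D \<rightarrow>\<^sub>E {0..<int n}" "f' \<in> arcs D \<rightarrow>\<^sub>E {0..<int n}"
        using f f' by (simp_all add: F)
      fix a assume "a \<in> arcs D"
      then obtain e where "e \<in> ends D" "a = arc_of D e"
        by (auto simp: arcs_def)
      then show "f a = f' a"
        using fun_cong[OF that, of e] by (simp add: pull_def)
    qed
    then show "(pull f = pull f') = (f = f')"
      by blast
  next
    fix f assume f: "f \<in> F"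
    then have mem: "f (arc_of D (c, q)) \<in> {0..<int n}" if "c \<in> crossings D" for c q
      using arc_mem[OF that] by (auto simp: F)
    have "[f (arc_of D (c, left_of q)) + f (arc_of D (c, right_of q)) = 2 * f (arc_of D (c, q))]
        (mod int n)" if c: "c \<in> crossings D" and q: "q \<in> over D c" for c q
    proof -
      \<comment> \<open>The presentation has this relation only for the outgoing end of the overcrossing strand.\<close>
      have rel: "[f (arc_of D (c, left_of q)) + f (arc_of D (c, right_of q)) = 2 * f (arc_of D (c, q))]
        (mod int n)" if "q \<in> over D c" "out (c, q)" for q
        unfolding dihedral_op_eq_iff[OF mem[OF c], symmetric] using f c that by (simp add: F)
      show ?thesis
      proof (cases "out (c, q)")
        case True
        then show ?thesis
          using rel q by blast
      next
        case False
        \<comment> \<open>Otherwise the relation belongs to the opposite end, which is outgoing.\<close>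
        then have "out (c, opposite q)"
          using out c by (simp add: is_orientation_def)
        from rel[OF opposite_in_over[OF D c q] this] show ?thesis
          by (simp add: left_of_opposite right_of_opposite arc_over[OF c q] add.commute)
      qed
    qed
    moreover have "pull f \<in> ends D \<rightarrow>\<^sub>E {0..<int n}"
      using mem by (auto simp: pull_def ends_def)
    ultimately show "pull f \<in> fox_colorings D n"
      using joined_mem
      by (auto simp: fox_colorings_def pull_def ends_mem arc_over arc_joined)
  next
    fix g assume g: "g \<in> fox_colorings D n"
    define f where "f = (\<lambda>a\<in>arcs D. g (SOME e. e \<in> a))"
    have f: "f (arc_of D e) = g e" if "e \<in> ends D" for e
    proof -
      have "e \<in> arc_of D e"
        by (simp add: arc_of_def)
      then have "(SOME e'. e' \<in> arc_of D e) \<in> arc_of D e"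
        by (rule someI)
      then have "g e = g (SOME e'. e' \<in> arc_of D e)"
        using fox_coloring_constant_on_arcs[OF g] by (auto simp: arc_of_def)
      then show ?thesis
        using that by (simp add: f_def arcs_def)
    qed
    have g_mem: "g e \<in> {0..<int n}" if "e \<in> ends D" for e
      using g that by (auto simp: fox_colorings_def)
    have "f \<in> arcs D \<rightarrow>\<^sub>E {0..<int n}"
    proof (rule PiE_I)
      show "f a \<in> {0..<int n}" if "a \<in> arcs D" for a
        using that f g_mem by (auto simp: arcs_def)
    qed (simp add: f_def)
    moreover have "f (arc_of D (c, left_of q)) =
          (2 * f (arc_of D (c, q)) - f (arc_of D (c, right_of q))) mod int n"
      if "c \<in> crossings D" "q \<in> over D c" for c q
    proof -
      have "(c, r) \<in> ends D" for r
        using that by (simp add: ends_mem)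
      then show ?thesis
        using g that by (simp add: f dihedral_op_eq_iff[OF g_mem] fox_colorings_def)
    qed
    ultimately have "f \<in> F"
      by (simp add: F)
    moreover have "g = pull f"
      using g by (intro ext) (auto simp: pull_def f fox_colorings_def PiE_def extensional_def)
    ultimately show "\<exists>f\<in>F. g = pull f"
      by blast
  qed
  then have "card F = card (fox_colorings D n)"
    by (rule bij_betw_same_card)
  then show ?thesis
    using card_quandle_hom_presented_quandle[OF is_quandle_dihedral_quandle[OF n], of "arcs D" ?R]
    by (simp add: coloring_number_def fundamental_quandle_def F_def)
qed

section \<open>Colorings of a pretzel link\<close>

text \<open>The labels at the north-west corners of the columns, which are also the labels of the arcs
  joining the tops of neighbouring columns.  The common value \<open>t\<close> expresses that the labels agree
  along the edges joining the bottoms.\<close>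

definition top_colorings :: "nat \<Rightarrow> nat \<Rightarrow> (nat \<Rightarrow> int) \<Rightarrow> (nat \<Rightarrow> int) set" where
  "top_colorings n m p =
     {x \<in> {1..m} \<rightarrow>\<^sub>E {0..<int n}. \<exists>t. \<forall>i\<in>{1..m}. [p i * (x (next_col m i) - x i) = t] (mod int n)}"

text \<open>The corners of a column, ordered by how often the top difference has been added to the north-west
  label when the corner is reached.  At a positive crossing the two overcrossing corners
  have the same height, the undercrossing corner NW has one less and SE one more.\<close>

definition twist_height :: "nat \<Rightarrow> corner \<Rightarrow> int" where
  "twist_height k q = (case q of NW \<Rightarrow> int k - 1 | NE \<Rightarrow> int k | SW \<Rightarrow> int k | SE \<Rightarrow> int k + 1)"

lemma next_col_mem: "i \<in> {1..m} \<Longrightarrow> next_col m i \<in> {1..m}"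
  and prev_col_mem: "i \<in> {1..m} \<Longrightarrow> prev_col m i \<in> {1..m}"
  and next_prev_col: "i \<in> {1..m} \<Longrightarrow> next_col m (prev_col m i) = i"
  by (auto simp: next_col_def prev_col_def)

lemma cyclically_cong_imp_constant:
  fixes f :: "nat \<Rightarrow> int"
  assumes "\<And>i. i \<in> {1..m} \<Longrightarrow> [f i = f (next_col m i)] (mod N)"
  shows "\<exists>t. \<forall>i\<in>{1..m}. [f i = t] (mod N)"
proof -
  have "[f i = f 1] (mod N)" if "1 \<le> i" "i \<le> m" for i
    using that
  proof (induction i rule: dec_induct)
    case (step i)
    then have "[f i = f (Suc i)] (mod N)"
      using assms[of i] by (simp add: next_col_def)
    then show ?case
      using step by (metis Suc_leD cong_sym cong_trans)
  qed simp
  then show ?thesis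
    by (intro exI[of _ "f 1"]) auto
qed

lemma pretzel_link_simps:
  "joined (pretzel_link m p) = pretzel_joined m p"
  "(i, k) \<in> crossings (pretzel_link m p) \<longleftrightarrow> i \<in> {1..m} \<and> 1 \<le> k \<and> k \<le> nat \<bar>p i\<bar>"
  "((i, k), q) \<in> ends (pretzel_link m p) \<longleftrightarrow> i \<in> {1..m} \<and> 1 \<le> k \<and> k \<le> nat \<bar>p i\<bar>"
  "p i > 0 \<Longrightarrow> over (pretzel_link m p) (i, k) = {NE, SW}"
  by (auto simp: pretzel_link_def ends_def)

text \<open>A crossing continues the arithmetic progression of labels by one term, and the two labels at its
  bottom are those at the top of the crossing beneath.\<close>

lemma twist_region_coloring:
  assumes p: "\<And>i. i \<in> {1..m} \<Longrightarrow> p i > 0" and g: "g \<in> fox_colorings (pretzel_link m p) n"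
    and i: "i \<in> {1..m}" and k: "1 \<le> k" "k \<le> nat (p i)"
  shows "[g ((i, k), q) = g ((i, 1), NW) +
    twist_height k q * (g ((next_col m i, 1), NW) - g ((i, 1), NW))] (mod int n)"
proof -
  let ?x = "g ((i, 1), NW)" and ?y = "g ((next_col m i, 1), NW)"
  have pi: "p i > 0"
    using p i .
  have joined: "g (pretzel_joined m p ((i, l), q)) = g ((i, l), q)"
    if "1 \<le> l" "l \<le> nat (p i)" for l q
  proof -
    have "((i, l), q) \<in> ends (pretzel_link m p)"
      using that i pi by (simp add: pretzel_link_simps)
    then show ?thesis
      using g by (auto simp: fox_colorings_def pretzel_link_simps)
  qed
  have crossing: "g ((i, l), SW) = g ((i, l), NE)"
      "[g ((i, l), NW) + g ((i, l), SE) = 2 * g ((i, l), NE)] (mod int n)"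
    if "1 \<le> l" "l \<le> nat (p i)" for l
  proof -
    have "(i, l) \<in> crossings (pretzel_link m p)" "NE \<in> over (pretzel_link m p) (i, l)"
      using that i pi by (simp_all add: pretzel_link_simps)
    then show "g ((i, l), SW) = g ((i, l), NE)"
      "[g ((i, l), NW) + g ((i, l), SE) = 2 * g ((i, l), NE)] (mod int n)"
      using g unfolding fox_colorings_def by (force simp: right_of_def)+
  qed
  have twist: "\<forall>q. [g ((i, l), q) = ?x + twist_height l q * (?y - ?x)] (mod int n)"
    if l: "1 \<le> l" "l \<le> nat (p i)"
      and NW: "[g ((i, l), NW) = ?x + twist_height l NW * (?y - ?x)] (mod int n)"
      and NE: "[g ((i, l), NE) = ?x + twist_height l NE * (?y - ?x)] (mod int n)" for l
  proof -
    have "[g ((i, l), NW) + g ((i, l), SE) - g ((i, l), NW) =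
        2 * (?x + twist_height l NE * (?y - ?x)) - (?x + twist_height l NW * (?y - ?x))] (mod int n)"
      using cong_trans[OF crossing(2)[OF l] cong_scalar_left[OF NE]] NW by (rule cong_diff)
    then have "[g ((i, l), SE) = ?x + twist_height l SE * (?y - ?x)] (mod int n)"
      by (simp add: twist_height_def algebra_simps)
    moreover have "[g ((i, l), SW) = ?x + twist_height l SW * (?y - ?x)] (mod int n)"
      using NE crossing(1)[OF l] by (simp add: twist_height_def)
    ultimately have "[g ((i, l), q) = ?x + twist_height l q * (?y - ?x)] (mod int n)" for q
      using NW NE by (cases q) (simp_all only:)
    then show ?thesis
      by blast
  qed
  have "\<forall>q. [g ((i, k), q) = ?x + twist_height k q * (?y - ?x)] (mod int n)"
    using k
  proof (induction k rule: dec_induct)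
    case base
    then show ?case
      using joined[of 1 NE] by (intro twist) (auto simp: twist_height_def)
  next
    case (step k)
    then have "g ((i, Suc k), NW) = g ((i, k), SW)" "g ((i, Suc k), NE) = g ((i, k), SE)"
      using joined[of "Suc k" NW] joined[of "Suc k" NE] by simp_all
    moreover have "[g ((i, k), SW) = ?x + twist_height k SW * (?y - ?x)] (mod int n)"
      "[g ((i, k), SE) = ?x + twist_height k SE * (?y - ?x)] (mod int n)"
      using step.IH step.prems by simp_all
    ultimately show ?case
      using step.prems by (intro twist) (auto simp: twist_height_def add.commute)
  qed
  then show ?thesis
    by blast
qed

text \<open>The labels at the top determine the coloring by \<open>twist_region_coloring\<close>.  Conversely any top
  labels spread over the columns as arithmetic progressions, and the only condition that is not
  automatic comes from the edges joining the bottoms: column \<open>i\<close> ends at \<open>x (i + 1) + p i * d i\<close> on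
  its right, and column \<open>i + 1\<close> ends at \<open>x (i + 1) + p (i + 1) * d (i + 1)\<close> on its left.\<close>

lemma card_fox_colorings_pretzel_link:
  assumes n: "n > 0" and p: "\<And>i. i \<in> {1..m} \<Longrightarrow> p i > 0"
  shows "card (fox_colorings (pretzel_link m p) n) = card (top_colorings n m p)"
proof -
  let ?D = "pretzel_link m p"
  let ?step = "\<lambda>x i. x (next_col m i) - x i"
  define val where "val x e = (case e of ((i, k), q) \<Rightarrow> x i + twist_height k q * ?step x i)"
    for x :: "nat \<Rightarrow> int" and e :: "(nat \<times> nat) \<times> corner"
  define spread where "spread x = (\<lambda>e\<in>ends ?D. val x e mod int n)" for x
  define top where "top g = (\<lambda>i\<in>{1..m}. g ((i, 1), NW))" for g :: "(nat \<times> nat) \<times> corner \<Rightarrow> int"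
  have D: "is_diagram ?D"
    using p by (intro is_diagram_pretzel_link) force
  have nat_p: "1 \<le> nat (p i)" "int (nat (p i)) = p i" "\<bar>p i\<bar> = p i" if "i \<in> {1..m}" for i
    using p[OF that] by simp_all
  have top_end: "((i, 1), NW) \<in> ends ?D" if "i \<in> {1..m}" for i
    using that nat_p[OF that] by (simp add: pretzel_link_simps)
  have spread: "[spread x e = val x e] (mod int n)" if "e \<in> ends ?D" for x e
    using that by (simp add: spread_def cong_def)
  have spread_in: "spread x \<in> ends ?D \<rightarrow>\<^sub>E {0..<int n}" for x
    using n by (simp add: spread_def)
  have top_in: "top g \<in> {1..m} \<rightarrow>\<^sub>E {0..<int n}" if "g \<in> fox_colorings ?D n" for g
    using that top_end by (auto simp: top_def fox_colorings_def)
  have val_top: "[g e = val (top g) e] (mod int n)"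
    if g: "g \<in> fox_colorings ?D n" and "e \<in> ends ?D" for g e
  proof -
    obtain i k q where e: "e = ((i, k), q)"
      by (metis surj_pair)
    then have "i \<in> {1..m}" "1 \<le> k" "k \<le> nat (p i)"
      using that nat_p by (auto simp: pretzel_link_simps)
    then show ?thesis
      using twist_region_coloring[OF p g, of i k q] next_col_mem by (simp add: e val_def top_def)
  qed
  have "bij_betw top (fox_colorings ?D n) (top_colorings n m p)"
  proof (rule bij_betwI[where g = spread])
    show "top \<in> fox_colorings ?D n \<rightarrow> top_colorings n m p"
    proof
      fix g assume g: "g \<in> fox_colorings ?D n"
      let ?x = "top g"
      have "[p i * ?step ?x i = p (next_col m i) * ?step ?x (next_col m i)] (mod int n)"
        if i: "i \<in> {1..m}" for i
      proof -
        let ?j = "next_col m i"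
        have j: "?j \<in> {1..m}"
          using next_col_mem i .
        have ends: "((i, nat (p i)), SE) \<in> ends ?D" "((?j, nat (p ?j)), SW) \<in> ends ?D"
          using i j nat_p by (simp_all add: pretzel_link_simps)
        have "g (joined ?D ((i, nat (p i)), SE)) = g ((i, nat (p i)), SE)"
          using g ends by (simp only: fox_colorings_def mem_Collect_eq)
        then have "g ((i, nat (p i)), SE) = g ((?j, nat (p ?j)), SW)"
          using nat_p i j by (simp add: pretzel_link_simps)
        then have "[val ?x ((i, nat (p i)), SE) = val ?x ((?j, nat (p ?j)), SW)] (mod int n)"
          using val_top[OF g ends(1)] val_top[OF g ends(2)] by (metis cong_sym cong_trans)
        then show ?thesis
          using nat_p i j by (simp add: val_def twist_height_def cong_iff_dvd_diff algebra_simps)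
      qed
      then have "\<exists>t. \<forall>i\<in>{1..m}. [p i * ?step ?x i = t] (mod int n)"
        by (rule cyclically_cong_imp_constant[where f = "\<lambda>i. p i * ?step ?x i"])
      then show "?x \<in> top_colorings n m p"
        using top_in[OF g] by (simp add: top_colorings_def)
    qed
    show "spread \<in> top_colorings n m p \<rightarrow> fox_colorings ?D n"
    proof
      fix x assume "x \<in> top_colorings n m p"
      then obtain t where t: "\<And>i. i \<in> {1..m} \<Longrightarrow> [p i * ?step x i = t] (mod int n)"
        unfolding top_colorings_def by blast
      have bottom: "[p i * ?step x i = p j * ?step x j] (mod int n)"
        if "i \<in> {1..m}" "j \<in> {1..m}" for i j
        using t that by (metis cong_sym cong_trans)
      have "spread x (joined ?D e) = spread x e" if e: "e \<in> ends ?D" for e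
      proof -
        obtain i k q where e_eq: "e = ((i, k), q)"
          by (metis surj_pair)
        have i: "i \<in> {1..m}" "1 \<le> k" "k \<le> nat (p i)"
          using e nat_p by (auto simp: e_eq pretzel_link_simps)
        note ni = next_col_mem[OF i(1)] and pri = prev_col_mem[OF i(1)]
        have "[val x (joined ?D e) = val x e] (mod int n)"
        proof (cases q)
          case NE
          then show ?thesis
            using i by (simp add: e_eq pretzel_link_simps val_def twist_height_def of_nat_diff)
        next
          case NW
          then show ?thesis
            using i next_prev_col[OF i(1)]
            by (simp add: e_eq pretzel_link_simps val_def twist_height_def of_nat_diff)
        next
          case SW
          then show ?thesis
            using i next_prev_col[OF i(1)] nat_p[OF i(1)] nat_p[OF pri] bottom[OF pri i(1)]
            by (simp add: e_eq pretzel_link_simps val_def twist_height_def cong_iff_dvd_diff algebra_simps)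
        next
          case SE
          then show ?thesis
            using i nat_p[OF i(1)] nat_p[OF ni] bottom[OF ni i(1)]
            by (simp add: e_eq pretzel_link_simps val_def twist_height_def cong_iff_dvd_diff algebra_simps)
        qed
        moreover have "joined ?D e \<in> ends ?D"
          using D e by (simp add: is_diagram_def)
        ultimately show ?thesis
          using e by (simp add: spread_def cong_def)
      qed
      moreover have "spread x (c, opposite q) = spread x (c, q) \<and>
          [spread x (c, left_of q) + spread x (c, right_of q) = 2 * spread x (c, q)] (mod int n)"
        if c: "c \<in> crossings ?D" and q: "q \<in> over ?D c" for c q
      proof -
        obtain i k where ik: "c = (i, k)"
          by fastforce
        then have i: "i \<in> {1..m}"
          using c by (simp add: pretzel_link_simps)
        then have q': "q = NE \<or> q = SW"
          using q p by (simp add: ik pretzel_link_simps)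
        have ends: "(c, r) \<in> ends ?D" for r
          using c by (simp add: ends_def)
        have "[spread x (c, left_of q) + spread x (c, right_of q) =
            val x (c, left_of q) + val x (c, right_of q)] (mod int n)"
          by (intro cong_add spread ends)
        also have "val x (c, left_of q) + val x (c, right_of q) = 2 * val x (c, q)"
          using q' by (auto simp: ik val_def twist_height_def right_of_def algebra_simps)
        also have "[2 * val x (c, q) = 2 * spread x (c, q)] (mod int n)"
          by (intro cong_scalar_left cong_sym[OF spread] ends)
        finally have "[spread x (c, left_of q) + spread x (c, right_of q) = 2 * spread x (c, q)]
            (mod int n)" .
        moreover have "val x (c, opposite q) = val x (c, q)"
          using q' by (auto simp: ik val_def twist_height_def)
        ultimately show ?thesis
          using ends by (simp add: spread_def)
      qed
      ultimately show "spread x \<in> fox_colorings ?D n"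
        using spread_in unfolding fox_colorings_def by blast
    qed
    show "spread (top g) = g" if g: "g \<in> fox_colorings ?D n" for g
    proof (rule PiE_ext[OF spread_in])
      show g_in: "g \<in> ends ?D \<rightarrow>\<^sub>E {0..<int n}"
        using g by (simp add: fox_colorings_def)
      fix e assume e: "e \<in> ends ?D"
      show "spread (top g) e = g e"
        using PiE_mem[OF spread_in e] PiE_mem[OF g_in e]
          cong_trans[OF spread[OF e] cong_sym[OF val_top[OF g e]]]
        by (rule residue_eqI)
    qed
    show "top (spread x) = x" if x: "x \<in> top_colorings n m p" for x
    proof (rule PiE_ext)
      show x_in: "x \<in> {1..m} \<rightarrow>\<^sub>E {0..<int n}"
        using x by (simp add: top_colorings_def)
      show "top (spread x) \<in> {1..m} \<rightarrow>\<^sub>E {0..<int n}"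
        unfolding top_def by (intro restrict_PiE_iff[THEN iffD2] ballI PiE_mem[OF spread_in] top_end)
      fix i assume i: "i \<in> {1..m}"
      then show "top (spread x) i = x i"
        using top_end[OF i] PiE_mem[OF x_in i] by (simp add: top_def spread_def val_def twist_height_def)
    qed
  qed
  then show ?thesis
    by (rule bij_betw_same_card)
qed

text \<open>These are the differences between neighbouring top labels: the columns are arranged in a circle, so
  the differences sum to zero, and \<open>t\<close> is the total amount by which a column raises its labels.\<close>

definition slopes :: "nat \<Rightarrow> 'i set \<Rightarrow> ('i \<Rightarrow> int) \<Rightarrow> ('i \<Rightarrow> int) set" where
  "slopes n I p =
     {d \<in> I \<rightarrow>\<^sub>E {0..<int n}. [(\<Sum>i\<in>I. d i) = 0] (mod int n) \<and>
        (\<exists>t. \<forall>i\<in>I. [p i * d i = t] (mod int n))}"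

text \<open>A cyclic sequence is given by its first term together with its successive differences, which must
  sum to zero.\<close>

lemma card_top_colorings:
  assumes n: "n > 0" and m: "m \<ge> 1"
  shows "card (top_colorings n m p) = n * card (slopes n {1..m} p)"
proof -
  define diff where "diff x = (\<lambda>i\<in>{1..m}. (x (next_col m i) - x i) mod int n)" for x
  define path where "path c d = (\<lambda>i\<in>{1..m}. (c + (\<Sum>k\<in>{1..<i}. d k)) mod int n)"
    for c and d :: "nat \<Rightarrow> int"
  have diff: "[diff x i = x (next_col m i) - x i] (mod int n)" if "i \<in> {1..m}" for x i
    using that by (simp add: diff_def cong_def)
  have path: "[path c d i = c + (\<Sum>k\<in>{1..<i}. d k)] (mod int n)" if "i \<in> {1..m}" for c d i
    using that by (simp add: path_def cong_def)
  have diff_in: "diff x \<in> {1..m} \<rightarrow>\<^sub>E {0..<int n}" for x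
    using n by (simp add: diff_def)
  have path_in: "path c d \<in> {1..m} \<rightarrow>\<^sub>E {0..<int n}" for c d
    using n by (simp add: path_def)
  have step: "[path c d (next_col m i) - path c d i = d i] (mod int n)"
    if i: "i \<in> {1..m}" and d: "[(\<Sum>k\<in>{1..m}. d k) = 0] (mod int n)" for c d i
  proof -
    have "[path c d (next_col m i) = c + (\<Sum>k\<in>{1..<Suc i}. d k)] (mod int n)"
    proof (cases "i = m")
      case True
      \<comment> \<open>The last column is followed by the first one; here the differences have to sum to zero.\<close>
      have "[path c d 1 = c + 0] (mod int n)"
        using path[of 1 c d] m by simp
      also have "[c + 0 = c + (\<Sum>k\<in>{1..m}. d k)] (mod int n)"
        using d by (intro cong_add) (auto simp: cong_sym_eq)
      finally show ?thesis
        using True by (simp add: next_col_def atLeastLessThanSuc_atLeastAtMost)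
    next
      case False
      then show ?thesis
        using path[of "Suc i" c d] i by (simp add: next_col_def)
    qed
    from cong_diff[OF this path[OF i, of c d]] show ?thesis
      using i by simp
  qed
  have "bij_betw (\<lambda>x. (x 1, diff x)) (top_colorings n m p) ({0..<int n} \<times> slopes n {1..m} p)"
  proof (rule bij_betwI[where g = "\<lambda>(c, d). path c d"])
    show "(\<lambda>x. (x 1, diff x)) \<in> top_colorings n m p \<rightarrow> {0..<int n} \<times> slopes n {1..m} p"
    proof
      fix x assume x: "x \<in> top_colorings n m p"
      then obtain t where t: "\<And>i. i \<in> {1..m} \<Longrightarrow> [p i * (x (next_col m i) - x i) = t] (mod int n)"
        unfolding top_colorings_def by blast
      have "\<forall>i\<in>{1..m}. [p i * diff x i = t] (mod int n)"
        using diff t by (meson cong_scalar_left cong_trans)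
      moreover have "[(\<Sum>i\<in>{1..m}. diff x i) = (\<Sum>i\<in>{1..m}. x (next_col m i) - x i)] (mod int n)"
        using diff by (intro cong_sum) auto
      moreover have "(\<Sum>i\<in>{1..m}. x (next_col m i) - x i) = 0"
      proof -
        have "{1..m} = insert m {1..<m}"
          using m by auto
        then have "(\<Sum>i\<in>{1..m}. x (next_col m i) - x i) =
            (x (next_col m m) - x m) + (\<Sum>i\<in>{1..<m}. x (next_col m i) - x i)"
          by simp
        also have "(\<Sum>i\<in>{1..<m}. x (next_col m i) - x i) = (\<Sum>i\<in>{1..<m}. x (Suc i) - x i)"
          by (intro sum.cong) (auto simp: next_col_def)
        finally have "(\<Sum>i\<in>{1..m}. x (next_col m i) - x i) =
            (x 1 - x m) + (\<Sum>i\<in>{1..<m}. x (Suc i) - x i)"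
          by (simp add: next_col_def)
        then show ?thesis
          using sum_Suc_diff'[OF m, of x] by simp
      qed
      ultimately have "diff x \<in> slopes n {1..m} p"
        using diff_in unfolding slopes_def by fastforce
      then show "(x 1, diff x) \<in> {0..<int n} \<times> slopes n {1..m} p"
        using x m by (auto simp: top_colorings_def)
    qed
    show "(\<lambda>(c, d). path c d) \<in> {0..<int n} \<times> slopes n {1..m} p \<rightarrow> top_colorings n m p"
    proof (clarify)
      fix c d assume d: "d \<in> slopes n {1..m} p"
      then obtain t where t: "\<And>i. i \<in> {1..m} \<Longrightarrow> [p i * d i = t] (mod int n)"
        unfolding slopes_def by blast
      have "[p i * (path c d (next_col m i) - path c d i) = t] (mod int n)" if i: "i \<in> {1..m}" for i
        using cong_trans[OF cong_scalar_left[OF step[OF i, of d c], of "p i"] t[OF i]] d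
        by (simp add: slopes_def)
      then show "path c d \<in> top_colorings n m p"
        using path_in unfolding top_colorings_def by blast
    qed
    show "(case (x 1, diff x) of (c, d) \<Rightarrow> path c d) = x" if x: "x \<in> top_colorings n m p" for x
    proof -
      have "path (x 1) (diff x) = x"
      proof (rule PiE_ext[OF path_in])
        show x_in: "x \<in> {1..m} \<rightarrow>\<^sub>E {0..<int n}"
          using x by (simp add: top_colorings_def)
        fix i assume i: "i \<in> {1..m}"
        have "[(\<Sum>k\<in>{1..<i}. diff x k) = (\<Sum>k\<in>{1..<i}. x (Suc k) - x k)] (mod int n)"
        proof (rule cong_sum)
          fix k assume "k \<in> {1..<i}"
          then show "[diff x k = x (Suc k) - x k] (mod int n)"
            using diff[of k x] i by (simp add: next_col_def)
        qed
        also have "(\<Sum>k\<in>{1..<i}. x (Suc k) - x k) = x i - x 1"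
          using i by (intro sum_Suc_diff') auto
        finally have "[x 1 + (\<Sum>k\<in>{1..<i}. diff x k) = x 1 + (x i - x 1)] (mod int n)"
          by (rule cong_add[OF cong_refl])
        with path[OF i] have "[path (x 1) (diff x) i = x i] (mod int n)"
          by (metis cong_trans add_diff_cancel_left' diff_add_cancel add.commute)
        then show "path (x 1) (diff x) i = x i"
          using PiE_mem[OF path_in i] PiE_mem[OF x_in i] by (intro residue_eqI)
      qed
      then show ?thesis
        by simp
    qed
    show "((case cd of (c, d) \<Rightarrow> path c d) 1, diff (case cd of (c, d) \<Rightarrow> path c d)) = cd"
      if cd: "cd \<in> {0..<int n} \<times> slopes n {1..m} p" for cd
    proof -
      obtain c d where cd_eq: "cd = (c, d)" and c: "c \<in> {0..<int n}" and d: "d \<in> slopes n {1..m} p"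
        using cd by auto
      have "diff (path c d) = d"
      proof (rule PiE_ext[OF diff_in])
        show d_in: "d \<in> {1..m} \<rightarrow>\<^sub>E {0..<int n}"
          using d by (simp add: slopes_def)
        fix i assume i: "i \<in> {1..m}"
        have "[diff (path c d) i = d i] (mod int n)"
          using cong_trans[OF diff[OF i, of "path c d"] step[OF i, of d c]] d by (simp add: slopes_def)
        then show "diff (path c d) i = d i"
          using PiE_mem[OF diff_in i] PiE_mem[OF d_in i] by (intro residue_eqI)
      qed
      moreover have "path c d 1 = c"
        using c m by (simp add: path_def)
      ultimately show ?thesis
        by (simp add: cd_eq)
    qed
  qed
  then have "card (top_colorings n m p) = card ({0..<int n} \<times> slopes n {1..m} p)"
    by (rule bij_betw_same_card)
  then show ?thesis
    by (simp add: card_cartesian_product)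
qed

theorem coloring_number_pretzel_link:
  assumes "n > 0" and "m \<ge> 1" and "\<And>i. i \<in> {1..m} \<Longrightarrow> p i > 0"
    and "is_orientation (pretzel_link m p) out"
  shows "coloring_number (pretzel_link m p) out (dihedral_quandle n) = n * card (slopes n {1..m} p)"
proof -
  have "is_diagram (pretzel_link m p)"
    using assms(3) by (intro is_diagram_pretzel_link) force
  then have "coloring_number (pretzel_link m p) out (dihedral_quandle n) =
      card (fox_colorings (pretzel_link m p) n)"
    using assms by (intro coloring_number_dihedral_quandle)
  then show ?thesis
    using card_fox_colorings_pretzel_link[OF assms(1,3)] card_top_colorings[OF assms(1,2)] by simp
qed

section \<open>Counting the admissible differences\<close>

text \<open>The sum on the right is the elementary symmetric polynomial of degree \<open>card I - 1\<close> in the \<open>p i\<close>,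
  and it is the product of the \<open>p i\<close> times the sum of their inverses.  The differences are the
  multiples \<open>t * inverse (p i)\<close> of a single family, so their sum vanishes exactly if \<open>t\<close> annihilates
  that polynomial.\<close>

lemma card_slopes_units:
  assumes n: "prime n" and I: "finite I" "I \<noteq> {}"
    and p: "\<And>i. i \<in> I \<Longrightarrow> \<not> int n dvd p i"
  shows "card (slopes n I p) = (if [(\<Sum>i\<in>I. \<Prod>j\<in>I - {i}. p j) = 0] (mod int n) then n else 1)"
proof -
  let ?h = "\<Sum>i\<in>I. \<Prod>j\<in>I - {i}. p j"
  let ?P = "\<Prod>i\<in>I. p i"
  have pn: "prime (int n)" and n0: "n > 0"
    using n prime_gt_0_nat by auto
  have cop: "coprime (p i) (int n)" if "i \<in> I" for i
    using p[OF that] pn by (metis coprime_commute prime_imp_coprime)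
  then have "\<exists>u. [p i * u = 1] (mod int n)" if "i \<in> I" for i
    using that by (metis cong_solve_coprime_int)
  then obtain u where u: "[p i * u i = 1] (mod int n)" if "i \<in> I" for i
    by metis
  have copP: "coprime ?P (int n)"
    using cop by (simp add: prod_coprime_left)
  have sum_zero_iff: "[(\<Sum>i\<in>I. d i) = 0] (mod int n) \<longleftrightarrow> [t * ?h = 0] (mod int n)"
    if "\<And>i. i \<in> I \<Longrightarrow> [p i * d i = t] (mod int n)" for d t
  proof -
    have "?P * d i = p i * d i * (\<Prod>j\<in>I - {i}. p j)" if "i \<in> I" for i
      using I(1) that by (simp add: prod.remove)
    then have "?P * (\<Sum>i\<in>I. d i) = (\<Sum>i\<in>I. p i * d i * (\<Prod>j\<in>I - {i}. p j))"
      unfolding sum_distrib_left by (intro sum.cong) auto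
    moreover have "[(\<Sum>i\<in>I. p i * d i * (\<Prod>j\<in>I - {i}. p j)) =
        (\<Sum>i\<in>I. t * (\<Prod>j\<in>I - {i}. p j))] (mod int n)"
      using that by (intro cong_sum cong_mult) auto
    ultimately have "[?P * (\<Sum>i\<in>I. d i) = t * ?h] (mod int n)"
      by (simp add: sum_distrib_left)
    moreover have "[?P * (\<Sum>i\<in>I. d i) = 0] (mod int n) \<longleftrightarrow> [(\<Sum>i\<in>I. d i) = 0] (mod int n)"
      using cong_mult_lcancel[OF copP, of _ 0] by simp
    ultimately show ?thesis
      unfolding cong_def by metis
  qed
  define line where "line t = (\<lambda>i\<in>I. (t * u i) mod int n)" for t
  have line: "[p i * line t i = t] (mod int n)" if "i \<in> I" for i t
  proof -
    have "[p i * line t i = p i * (t * u i)] (mod int n)"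
      using that by (simp add: line_def cong_mult cong_def mod_mult_right_eq)
    also have "p i * (t * u i) = t * (p i * u i)"
      by simp
    also have "[t * (p i * u i) = t * 1] (mod int n)"
      using u[OF that] by (rule cong_scalar_left)
    finally show ?thesis
      by simp
  qed
  have "bij_betw line {t \<in> {0..<int n}. [t * ?h = 0] (mod int n)} (slopes n I p)"
  proof (rule bij_betwI')
    fix t t' assume t: "t \<in> {t \<in> {0..<int n}. [t * ?h = 0] (mod int n)}"
      and t': "t' \<in> {t \<in> {0..<int n}. [t * ?h = 0] (mod int n)}"
    have "t = t'" if "line t = line t'"
    proof (rule residue_eqI)
      obtain i where "i \<in> I"
        using I by blast
      then show "[t = t'] (mod int n)"
        using line[of i t] line[of i t'] that by (metis cong_sym cong_trans)
    qed (use t t' in auto)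
    then show "(line t = line t') = (t = t')"
      by blast
  next
    fix t assume t: "t \<in> {t \<in> {0..<int n}. [t * ?h = 0] (mod int n)}"
    then have "[(\<Sum>i\<in>I. line t i) = 0] (mod int n)"
      using sum_zero_iff[of "line t" t] line by blast
    moreover have "line t \<in> I \<rightarrow>\<^sub>E {0..<int n}"
      using n0 by (simp add: line_def)
    ultimately show "line t \<in> slopes n I p"
      using line unfolding slopes_def by blast
  next
    fix d assume d: "d \<in> slopes n I p"
    then obtain t where t: "\<And>i. i \<in> I \<Longrightarrow> [p i * d i = t] (mod int n)"
      by (auto simp: slopes_def)
    define s where "s = t mod int n"
    have s: "[p i * d i = s] (mod int n)" if "i \<in> I" for i
      using t[OF that] by (simp add: s_def cong_def)
    have "[s * ?h = 0] (mod int n)"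
      using d sum_zero_iff[of d s] s by (auto simp: slopes_def)
    moreover have "d = line s"
    proof (rule PiE_ext)
      show "d \<in> I \<rightarrow>\<^sub>E {0..<int n}" "line s \<in> I \<rightarrow>\<^sub>E {0..<int n}"
        using d n0 by (simp_all add: slopes_def line_def)
      fix i assume i: "i \<in> I"
      have "[p i * d i = p i * line s i] (mod int n)"
        using s[OF i] line[OF i, of s] by (metis cong_sym cong_trans)
      then have "[d i = line s i] (mod int n)"
        using cong_mult_lcancel[OF cop[OF i]] by blast
      then show "d i = line s i"
        using d i n0 by (intro residue_eqI) (auto simp: slopes_def line_def)
    qed
    ultimately show "\<exists>t\<in>{t \<in> {0..<int n}. [t * ?h = 0] (mod int n)}. d = line t"
      using n0 by (intro bexI[of _ s]) (auto simp: s_def)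
  qed
  then have card: "card (slopes n I p) = card {t \<in> {0..<int n}. [t * ?h = 0] (mod int n)}"
    by (simp add: bij_betw_same_card)
  show ?thesis
  proof (cases "[?h = 0] (mod int n)")
    case True
    then have "{t \<in> {0..<int n}. [t * ?h = 0] (mod int n)} = {0..<int n}"
      by (auto simp: cong_0_iff)
    then show ?thesis
      using True card by simp
  next
    case False
    then have "t = 0" if "t \<in> {0..<int n}" "[t * ?h = 0] (mod int n)" for t
      using that pn n0 by (intro residue_eqI[of t n 0]) (auto simp: cong_0_iff prime_dvd_mult_iff)
    then have "{t \<in> {0..<int n}. [t * ?h = 0] (mod int n)} = {0}"
      using n0 by auto
    then show ?thesis
      using False card by simp
  qed
qed

text \<open>An index at which \<open>p\<close> vanishes forces the common product to be zero, so the differences live on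
  \<open>Z\<close> only.  All but one of them can be chosen freely, and the last is minus the sum of the others.\<close>

lemma card_slopes_nonunits:
  assumes n: "prime n" and I: "finite I" and Z: "Z = {i \<in> I. int n dvd p i}" "Z \<noteq> {}"
  shows "card (slopes n I p) = n ^ (card Z - 1)"
proof -
  have pn: "prime (int n)" and n0: "n > 0"
    using n prime_gt_0_nat by auto
  have finZ: "finite Z" and ZI: "Z \<subseteq> I"
    using I Z by auto
  obtain z where z: "z \<in> Z"
    using Z by blast
  have slopes: "d \<in> slopes n I p \<longleftrightarrow> d \<in> I \<rightarrow>\<^sub>E {0..<int n} \<and> (\<forall>i\<in>I - Z. d i = 0) \<and>
      [d z + (\<Sum>i\<in>Z - {z}. d i) = 0] (mod int n)" for d
  proof (cases "d \<in> I \<rightarrow>\<^sub>E {0..<int n}")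
    case True
    have "(\<exists>t. \<forall>i\<in>I. [p i * d i = t] (mod int n)) \<longleftrightarrow> (\<forall>i\<in>I - Z. d i = 0)"
    proof
      assume "\<exists>t. \<forall>i\<in>I. [p i * d i = t] (mod int n)"
      then obtain t where t: "\<And>i. i \<in> I \<Longrightarrow> [p i * d i = t] (mod int n)"
        by blast
      have "[p z * d z = 0] (mod int n)"
        using z Z by (simp add: cong_0_iff)
      moreover have "[p z * d z = t] (mod int n)"
        using z ZI t by blast
      ultimately have "[t = 0] (mod int n)"
        by (metis cong_sym cong_trans)
      then have "[p i * d i = 0] (mod int n)" if "i \<in> I" for i
        using t[OF that] by (metis cong_trans)
      then have "[d i = 0] (mod int n)" if "i \<in> I - Z" for i
        using that Z pn by (auto simp: cong_0_iff prime_dvd_mult_iff)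
      then show "\<forall>i\<in>I - Z. d i = 0"
        using True n0 by (intro ballI residue_eqI) auto
    next
      assume "\<forall>i\<in>I - Z. d i = 0"
      then have "\<forall>i\<in>I. [p i * d i = 0] (mod int n)"
        unfolding cong_0_iff using Z(1)
        by (metis (no_types, lifting) DiffI dvd_0_right dvd_mult2 mem_Collect_eq mult_zero_right)
      then show "\<exists>t. \<forall>i\<in>I. [p i * d i = t] (mod int n)"
        by blast
    qed
    moreover have "(\<Sum>i\<in>I. d i) = d z + (\<Sum>i\<in>Z - {z}. d i)" if "\<forall>i\<in>I - Z. d i = 0"
      using sum.mono_neutral_right[OF I ZI that] sum.remove[OF finZ z] by simp
    ultimately show ?thesis
      using True by (auto simp: slopes_def)
  qed (simp add: slopes_def)
  define extend where "extend e = (\<lambda>i\<in>I. if i = z then (- (\<Sum>j\<in>Z - {z}. e j)) mod int n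
    else if i \<in> Z then e i else 0)" for e :: "'a \<Rightarrow> int"
  have "bij_betw (\<lambda>d. restrict d (Z - {z})) (slopes n I p) ((Z - {z}) \<rightarrow>\<^sub>E {0..<int n})"
  proof (rule bij_betwI[where g = extend])
    show "(\<lambda>d. restrict d (Z - {z})) \<in> slopes n I p \<rightarrow> (Z - {z}) \<rightarrow>\<^sub>E {0..<int n}"
    proof
      fix d assume "d \<in> slopes n I p"
      then have "\<forall>i\<in>Z - {z}. d i \<in> {0..<int n}"
        using ZI unfolding slopes by blast
      then show "restrict d (Z - {z}) \<in> (Z - {z}) \<rightarrow>\<^sub>E {0..<int n}"
        by (simp only: restrict_PiE_iff)
    qed
    show "extend \<in> ((Z - {z}) \<rightarrow>\<^sub>E {0..<int n}) \<rightarrow> slopes n I p"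
    proof
      fix e assume e: "e \<in> (Z - {z}) \<rightarrow>\<^sub>E {0..<int n}"
      have "(\<Sum>i\<in>Z - {z}. extend e i) = (\<Sum>i\<in>Z - {z}. e i)"
        using ZI by (intro sum.cong) (auto simp: extend_def)
      then have "[extend e z + (\<Sum>i\<in>Z - {z}. extend e i) = 0] (mod int n)"
        using z ZI by (auto simp: extend_def cong_def mod_add_left_eq)
      moreover have "extend e \<in> I \<rightarrow>\<^sub>E {0..<int n}"
        using e n0 by (auto simp: extend_def PiE_iff)
      ultimately show "extend e \<in> slopes n I p"
        using z by (auto simp: slopes extend_def)
    qed
    show "extend (restrict d (Z - {z})) = d" if d: "d \<in> slopes n I p" for d
    proof (rule PiE_ext)
      show "d \<in> I \<rightarrow>\<^sub>E {0..<int n}"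
        using d by (simp add: slopes)
      then show "extend (restrict d (Z - {z})) \<in> I \<rightarrow>\<^sub>E {0..<int n}"
        using n0 by (auto simp: extend_def PiE_iff)
      fix i assume i: "i \<in> I"
      have "d z = (- (\<Sum>j\<in>Z - {z}. d j)) mod int n"
      proof (rule residue_eqI)
        show "d z \<in> {0..<int n}"
          using d z ZI by (auto simp: slopes)
        have "[d z = - (\<Sum>j\<in>Z - {z}. d j)] (mod int n)"
          using d by (simp add: slopes cong_iff_dvd_diff)
        then show "[d z = (- (\<Sum>j\<in>Z - {z}. d j)) mod int n] (mod int n)"
          by (simp add: cong_def)
      qed (use n0 in auto)
      then show "extend (restrict d (Z - {z})) i = d i"
        using i d by (auto simp: extend_def slopes)
    qed
    show "restrict (extend e) (Z - {z}) = e" if "e \<in> (Z - {z}) \<rightarrow>\<^sub>E {0..<int n}" for e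
      using that ZI by (intro ext) (auto simp: extend_def PiE_def extensional_def restrict_def)
  qed
  then have "card (slopes n I p) = card ((Z - {z}) \<rightarrow>\<^sub>E {0..<int n})"
    by (rule bij_betw_same_card)
  also have "\<dots> = n ^ (card Z - 1)"
    using finZ z by (simp add: card_PiE)
  finally show ?thesis .
qed

lemma sum_over_corank_one_subsets:
  assumes "finite I" "I \<noteq> {}"
  shows "(\<Sum>S | S \<subseteq> I \<and> card S = card I - 1. f S) = (\<Sum>i\<in>I. f (I - {i}))"
proof -
  have "S \<in> (\<lambda>i. I - {i}) ` I" if "S \<subseteq> I" "card S = card I - 1" for S
  proof -
    have "card (I - S) = 1"
      using that assms by (simp add: card_Diff_subset finite_subset card_gt_0_iff Suc_leI)
    then obtain i where "I - S = {i}"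
      by (auto simp: card_1_singleton_iff)
    then have "i \<in> I" "S = I - {i}"
      using that by auto
    then show ?thesis
      by blast
  qed
  then have "{S. S \<subseteq> I \<and> card S = card I - 1} = (\<lambda>i. I - {i}) ` I"
    using assms by auto
  moreover have "inj_on (\<lambda>i. I - {i}) I"
    by (auto simp: inj_on_def)
  ultimately show ?thesis
    by (simp add: sum.reindex)
qed

text \<open>With \<open>Z\<close> the set of columns whose number of crossings is a multiple of \<open>n\<close>, the coloring number
  depends only on \<open>card Z\<close> and, if \<open>Z\<close> is empty, on whether \<open>h\<close> vanishes.  The cases of the theorem
  are then conditions on \<open>card Z\<close>.\<close>

theorem theorem28:
  fixes n m :: nat and p :: "nat \<Rightarrow> int" and out :: "(nat \<times> nat) \<times> corner \<Rightarrow> bool" and h :: int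
  assumes "prime n" and "m \<ge> 1" and "\<forall>i\<in>{1..m}. p i > 0"
    and "is_orientation (pretzel_link m p) out"
    and "h = (\<Sum>S | S \<subseteq> {1..m} \<and> card S = m - 1. \<Prod>i\<in>S. p i)"
  shows
    "(\<not> [h = 0] (mod int n) \<longrightarrow>
        coloring_number (pretzel_link m p) out (dihedral_quandle n) = n) \<and>
     ([h = 0] (mod int n) \<and>
        \<not> (\<forall>S. S \<subseteq> {1..m} \<and> card S + 2 = m \<longrightarrow> [(\<Prod>i\<in>S. p i) = 0] (mod int n)) \<longrightarrow>
        coloring_number (pretzel_link m p) out (dihedral_quandle n) = n ^ 2) \<and>
     (\<forall>j. 3 \<le> j \<and> j + 3 \<le> m \<and> [h = 0] (mod int n) \<and> exactly_coprime n m p j \<longrightarrow>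
        coloring_number (pretzel_link m p) out (dihedral_quandle n) = n ^ (m - j)) \<and>
     (m \<ge> 3 \<and> [h = 0] (mod int n) \<and> exactly_coprime n m p 2 \<longrightarrow>
        coloring_number (pretzel_link m p) out (dihedral_quandle n) = n ^ (m - 2)) \<and>
     (m \<ge> 2 \<and> exactly_coprime n m p 1 \<longrightarrow>
        coloring_number (pretzel_link m p) out (dihedral_quandle n) = n ^ (m - 1)) \<and>
     ((\<forall>i\<in>{1..m}. [p i = 0] (mod int n)) \<longrightarrow>
        coloring_number (pretzel_link m p) out (dihedral_quandle n) = n ^ m)"
proof -
  let ?N = "coloring_number (pretzel_link m p) out (dihedral_quandle n)"
  let ?I = "{1..m}"
  define Z where "Z = {i \<in> ?I. int n dvd p i}"
  have n0: "n > 0" and pn: "prime (int n)"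
    using assms(1) prime_gt_0_nat by auto
  have finZ: "finite Z" and ZI: "Z \<subseteq> ?I"
    by (auto simp: Z_def)
  then have cardZ: "card Z \<le> m"
    using card_mono[of ?I Z] by simp
  have I_ne: "?I \<noteq> {}"
    using assms(2) by simp
  have h: "h = (\<Sum>i\<in>?I. \<Prod>j\<in>?I - {i}. p j)"
    using sum_over_corank_one_subsets[of ?I "\<lambda>S. prod p S"] I_ne assms(5) by simp
  have N: "?N = n * card (slopes n ?I p)"
    using assms n0 by (intro coloring_number_pretzel_link) auto
  have N_nonunit: "?N = n ^ card Z" if "card Z > 0"
  proof -
    have "card (slopes n ?I p) = n ^ (card Z - 1)"
      using that by (intro card_slopes_nonunits[OF assms(1) _ Z_def]) auto
    then show ?thesis
      using N that by (simp flip: power_Suc)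
  qed
  have N_unit: "?N = (if [h = 0] (mod int n) then n ^ 2 else n)" if "card Z = 0"
  proof -
    have "Z = {}"
      using that finZ by simp
    then have "card (slopes n ?I p) = (if [h = 0] (mod int n) then n else 1)"
      unfolding h by (intro card_slopes_units[OF assms(1) _ I_ne]) (auto simp: Z_def)
    then show ?thesis
      using N by (simp add: power2_eq_square)
  qed
  have prod_zero_iff: "[(\<Prod>i\<in>S. p i) = 0] (mod int n) \<longleftrightarrow> S \<inter> Z \<noteq> {}" if "S \<subseteq> ?I" for S
  proof -
    have "[(\<Prod>i\<in>S. p i) = 0] (mod int n) \<longleftrightarrow> (\<exists>i\<in>S. int n dvd p i)"
      using finite_subset[OF that] pn by (simp add: cong_0_iff prime_dvd_prod_iff)
    then show ?thesis
      using that unfolding Z_def by blast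
  qed
  have h_one: "\<not> [h = 0] (mod int n)" if one: "card Z = 1"
  proof -
    \<comment> \<open>The only summand of \<open>h\<close> that survives modulo \<open>n\<close> omits the single vanishing factor.\<close>
    obtain z where z: "Z = {z}"
      using one by (auto simp: card_1_singleton_iff)
    then have zI: "z \<in> ?I"
      using ZI by blast
    have "[(\<Prod>j\<in>?I - {i}. p j) = 0] (mod int n)" if "i \<in> ?I - {z}" for i
      using prod_zero_iff[of "?I - {i}"] that z zI by auto
    then have "int n dvd (\<Sum>i\<in>?I - {z}. \<Prod>j\<in>?I - {i}. p j)"
      unfolding cong_0_iff by (rule dvd_sum)
    moreover have "h = (\<Prod>j\<in>?I - {z}. p j) + (\<Sum>i\<in>?I - {z}. \<Prod>j\<in>?I - {i}. p j)"
      unfolding h using zI by (intro sum.remove) auto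
    moreover have "\<not> int n dvd (\<Prod>j\<in>?I - {z}. p j)"
      using prod_zero_iff[of "?I - {z}"] z by (auto simp: cong_0_iff)
    ultimately show ?thesis
      by (simp add: cong_0_iff dvd_add_left_iff)
  qed
  have h_many: "[h = 0] (mod int n)" if many: "card Z \<ge> 2"
  proof -
    \<comment> \<open>Omitting one factor still leaves a vanishing one in every summand.\<close>
    have "[(\<Prod>j\<in>?I - {i}. p j) = 0] (mod int n)" for i
    proof -
      have "\<not> Z \<subseteq> {i}"
        using many card_mono[of "{i}" Z] by auto
      then show ?thesis
        using prod_zero_iff[of "?I - {i}"] ZI by auto
    qed
    then show ?thesis
      unfolding h cong_0_iff by (intro dvd_sum)
  qed
  have few: "card Z \<le> 2" if S: "S \<subseteq> ?I" "card S + 2 = m" "\<not> [(\<Prod>i\<in>S. p i) = 0] (mod int n)" for S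
  proof -
    \<comment> \<open>A nonvanishing product avoids \<open>Z\<close>, so \<open>Z\<close> fits into the two omitted indices.\<close>
    have "Z \<subseteq> ?I - S"
      using S prod_zero_iff[OF S(1)] ZI by auto
    then have "card Z \<le> card (?I - S)"
      by (intro card_mono) auto
    also have "card (?I - S) = 2"
      using S finite_subset[OF S(1)] by (simp add: card_Diff_subset)
    finally show ?thesis .
  qed
  have exact: "card Z = m - j" if j: "exactly_coprime n m p j" for j
  proof -
    have "coprime (p i) (int n) \<longleftrightarrow> \<not> int n dvd p i" for i
      using pn by (metis coprime_absorb_right coprime_commute not_prime_unit prime_imp_coprime)
    then have "{i \<in> ?I. coprime (p i) (int n)} = ?I - Z"
      unfolding Z_def by blast
    then have "card (?I - Z) = j"
      using j by (simp add: exactly_coprime_def)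
    then show ?thesis
      using ZI finZ cardZ by (simp add: card_Diff_subset)
  qed
  show ?thesis
  proof (intro conjI impI allI)
    assume h0: "\<not> [h = 0] (mod int n)"
    then have "card Z = 0 \<or> card Z = 1"
      using h_many by linarith
    then show "?N = n"
      using N_nonunit N_unit h0 by auto
  next
    assume "[h = 0] (mod int n) \<and>
      \<not> (\<forall>S. S \<subseteq> ?I \<and> card S + 2 = m \<longrightarrow> [(\<Prod>i\<in>S. p i) = 0] (mod int n))"
    then have "[h = 0] (mod int n)" "card Z \<le> 2"
      using few by blast+
    moreover from this have "card Z \<noteq> 1"
      using h_one by blast
    ultimately have "card Z = 0 \<or> card Z = 2"
      by linarith
    then show "?N = n ^ 2"
      using N_nonunit N_unit \<open>[h = 0] (mod int n)\<close> by auto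
  next
    fix j assume "3 \<le> j \<and> j + 3 \<le> m \<and> [h = 0] (mod int n) \<and> exactly_coprime n m p j"
    then show "?N = n ^ (m - j)"
      using exact[of j] N_nonunit by auto
  next
    assume "m \<ge> 3 \<and> [h = 0] (mod int n) \<and> exactly_coprime n m p 2"
    then show "?N = n ^ (m - 2)"
      using exact[of 2] N_nonunit by auto
  next
    assume "m \<ge> 2 \<and> exactly_coprime n m p 1"
    then show "?N = n ^ (m - 1)"
      using exact[of 1] N_nonunit by auto
  next
    assume "\<forall>i\<in>?I. [p i = 0] (mod int n)"
    then have "Z = ?I"
      by (auto simp: Z_def cong_0_iff)
    then show "?N = n ^ m"
      using N_nonunit assms(2) by simp
  qed
qed

end
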